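(* Let $\lambda,\mu,\nu>0$ with $\rho:=\lambda/\mu<1$, let $\omega>0$, and assume $\mu-\lambda\le\nu$. Let $G(A)$, for $A\in\{0,1,\dots,\lceil(\mu-\lambda)/\nu-1\rceil\}$, be the stationary congestion cost of the system with lounge facility, let $G^*$ be the minimum of $G(A)$ over this set of $A$, with minimizer $A^*$, and let $G_o$ be the congestion cost without lounge facility (all as defined in the context). Put $$\overline{\omega}:=\frac{3-\rho}{1-\rho}.$$ If $\omega<\overline{\omega}$, then it is optimal for the system to provide the lounge facility with $A^*=0$; that is, $A^*=0$ attains $G^*$ and $\min\{G^*,G_o\}=G^*=G(0)$. Otherwise (if $\omega\ge\overline{\omega}$) it is better not to design the lounge; that is, $\min\{G^*,G_o\}=G_o$.
   Context: Model: a single-server queue with a lounge; Poisson arrivals of rate $\lambda$, exponential service times of rate $\mu$, exponential lounge stays of rate $\nu$ (each lounge customer then moves to the queue). An arriving customer goes to the lounge if the queue length $Q$ and the lounge size $L$ satisfy $Q>A$ and $L<B$, and joins the queue directly otherwise. If the queue becomes empty while the lounge is occupied, one lounge customer immediately moves to the queue. Here $Q$ includes the customer in service. Given an integer $A\in\{0,1,\dots,\lceil(\mu-\lambda)/\nu-1\rceil\}$ (the customer-response parameter, determined by the lounge comfort level chosen by the system), set $B=\lceil(\mu-\lambda)/\nu-A\rceil\ (\ge 1)$. The pair (queue length, lounge size) is the continuous-time Markov chain on the states $(0,0)$ and $(x,y)$ with $x\ge1$, $0\le y\le B$, with the following transition rates: - $(0,0)\to(1,0)$ at rate $\lambda$;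 - for $x\ge1$: $(x,y)\to(x,y+1)$ at rate $\lambda$ if $x>A$ and $y<B$; otherwise $(x,y)\to(x+1,y)$ at rate $\lambda$; - service completion, at rate $\mu$: $(x,y)\to(x-1,y)$ if $x\ge2$ or $y=0$ (with $x\ge1$), and $(1,y)\to(1,y-1)$ if $y>0$; - for $x\ge1$, $y>0$: $(x,y)\to(x+1,y-1)$ at rate $y\nu$. For $\rho<1$ this chain has a unique stationary distribution $(\pi_{q,l}(A))_{q,l}$. The congestion cost with lounge facility is $$G(A)=\sum_{q,l}(q^2+\omega l^2)\,\pi_{q,l}(A),$$ where $\omega>0$ is the weight on lounge congestion. The congestion cost without lounge facility (a standard M/M/1 queue) is $$G_o=\sum_{q\ge0}q^2\rho^q(1-\rho).$$ The optimal value over lounge designs acceptable to customers is $$G^*=\min\{G(A): A\in\{0,1,\dots,\lceil(\mu-\lambda)/\nu-1\rceil\}\},$$ with $A^*$ denoting the minimizer. The lounge design problem is to compute $\min\{G^*,G_o\}$: the lounge is provided with parameter $A^*$ if the minimum is $G^*$, and not provided if it is $G_o$. *)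

theory Defs
  imports "HOL-Probability.Probability_Mass_Function"
begin

section \<open>Stationary distributions of Markov chains given by transition rates\<close>

text \<open>
  A continuous-time chain on a state set \<open>S\<close> is given by its transition rates \<open>R s t\<close> for the
  jumps \<open>s \<rightarrow> t\<close>. Stationarity is the global balance equation (rate out of \<open>s\<close> = rate into \<open>s\<close>),
  i.e. \<open>p Q = 0\<close> for the generator \<open>Q\<close>; a term \<open>R s s\<close> would occur on both sides and cancel.
\<close>

definition stationary_distribution :: "'s set \<Rightarrow> ('s \<Rightarrow> 's \<Rightarrow> real) \<Rightarrow> 's pmf \<Rightarrow> bool" where
  "stationary_distribution S R p \<longleftrightarrow>
     set_pmf p \<subseteq> S \<and>
     (\<forall>s\<in>S. pmf p s * (\<Sum>\<^sub>\<infinity>t\<in>S. R s t) = (\<Sum>\<^sub>\<infinity>t\<in>S. pmf p t * R t s))"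


section \<open>The single-server queue with a lounge\<close>

text \<open>States are pairs (queue length including the customer in service, lounge size).\<close>

definition lounge_states :: "nat \<Rightarrow> (nat \<times> nat) set" where
  "lounge_states B = {(0, 0)} \<union> {(x, y). x \<ge> 1 \<and> y \<le> B}"

fun after_arrival :: "nat \<Rightarrow> nat \<Rightarrow> nat \<times> nat \<Rightarrow> nat \<times> nat" where
  "after_arrival A B (x, y) = (if x > A \<and> y < B then (x, y + 1) else (x + 1, y))"

text \<open>
  If the last customer of the queue departs while the lounge is occupied, a lounge customer moves
  to the queue at once.
\<close>

fun after_service :: "nat \<times> nat \<Rightarrow> nat \<times> nat" where
  "after_service (x, y) = (if x \<ge> 2 \<or> y = 0 then (x - 1, y) else (1, y - 1))"

fun lounge_rate ::
  "real \<Rightarrow> real \<Rightarrow> real \<Rightarrow> nat \<Rightarrow> nat \<Rightarrow> nat \<times> nat \<Rightarrow> nat \<times> nat \<Rightarrow> real" where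
  "lounge_rate lam \<mu> \<nu> A B (x, y) t =
     (if t = after_arrival A B (x, y) then lam else 0) +
     (if x \<ge> 1 \<and> t = after_service (x, y) then \<mu> else 0) +
     (if x \<ge> 1 \<and> y > 0 \<and> t = (x + 1, y - 1) then real y * \<nu> else 0)"

definition customer_responses :: "real \<Rightarrow> real \<Rightarrow> real \<Rightarrow> nat set" where
  "customer_responses lam \<mu> \<nu> = {A. int A \<le> \<lceil>(\<mu> - lam) / \<nu> - 1\<rceil>}"

definition lounge_capacity :: "real \<Rightarrow> real \<Rightarrow> real \<Rightarrow> nat \<Rightarrow> nat" where
  "lounge_capacity lam \<mu> \<nu> A = nat \<lceil>(\<mu> - lam) / \<nu> - real A\<rceil>"

definition lounge_stationary :: "real \<Rightarrow> real \<Rightarrow> real \<Rightarrow> nat \<Rightarrow> (nat \<times> nat) pmf" where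
  "lounge_stationary lam \<mu> \<nu> A =
     (let B = lounge_capacity lam \<mu> \<nu> A
      in THE p. stationary_distribution (lounge_states B) (lounge_rate lam \<mu> \<nu> A B) p)"


section \<open>Congestion costs\<close>

text \<open>
  The costs are sums of nonnegative terms and are taken in \<open>[0, \<infinity>]\<close>, so that a divergent sum has
  the value \<open>\<infinity>\<close> instead of the default value \<open>0\<close> of the real-valued infinite sum.
\<close>

definition lounge_cost :: "real \<Rightarrow> real \<Rightarrow> real \<Rightarrow> real \<Rightarrow> nat \<Rightarrow> ennreal" where
  "lounge_cost lam \<mu> \<nu> \<omega> A =
     (\<Sum>\<^sub>\<infinity>(q, l)\<in>lounge_states (lounge_capacity lam \<mu> \<nu> A).
        ennreal (((real q)\<^sup>2 + \<omega> * (real l)\<^sup>2) * pmf (lounge_stationary lam \<mu> \<nu> A) (q, l)))"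

definition no_lounge_cost :: "real \<Rightarrow> real \<Rightarrow> ennreal" where
  "no_lounge_cost lam \<mu> =
     (let \<rho> = lam / \<mu> in \<Sum>\<^sub>\<infinity>q. ennreal ((real q)\<^sup>2 * \<rho> ^ q * (1 - \<rho>)))"

definition optimal_lounge_cost :: "real \<Rightarrow> real \<Rightarrow> real \<Rightarrow> real \<Rightarrow> ennreal" where
  "optimal_lounge_cost lam \<mu> \<nu> \<omega> = Min (lounge_cost lam \<mu> \<nu> \<omega> ` customer_responses lam \<mu> \<nu>)"

end

theory Submission
  imports Defs
begin

text \<open>
  Since \<open>\<mu> - \<lambda> \<le> \<nu>\<close>, the only admissible parameter is \<open>A = 0\<close>, with \<open>B = 1\<close>. The server works
  whenever a customer is present, so the total number \<open>q + l\<close> is geometric with ratio \<open>\<rho>\<close>, as in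
  the queue without lounge. Inserting this into the balance equations at \<open>(x, 1)\<close> leaves a first-order
  recursion for \<open>\<pi>(x, 1)\<close> whose homogeneous solutions grow geometrically; boundedness then forces
  \<open>\<pi>(x, 1) = c \<rho>\<^sup>x\<close>, which gives uniqueness. The occupied lounge changes the cost
  \<open>(q + l)\<^sup>2\<close> by \<open>\<omega> - (2 q + 1)\<close>, and given \<open>l = 1\<close> the mean of \<open>q\<close> is \<open>1 / (1 - \<rho>)\<close>, so the
  sign of the difference is decided by \<open>\<omega>\<close> against \<open>2 / (1 - \<rho>) + 1 = (3 - \<rho>) / (1 - \<rho>)\<close>.
\<close>

section \<open>Sums, bounded recursions and probability mass functions\<close>

text \<open>Every state has finitely many neighbours, so this turns the infinite sums in the balance
  equations into finite ones.\<close>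

lemma infsum_eq_sum_support:
  assumes "finite T" "T \<subseteq> A" "\<And>x. x \<in> A - T \<Longrightarrow> f x = 0"
  shows "infsum f A = sum f T"
  by (rule infsumI, rule has_sum_finite_neutralI) (use assms in auto)

text \<open>On nonnegative terms \<open>ennreal\<close> commutes with finite sums, and it is
  continuous, so the limit of the partial sums passes through it. This carries real series over to
  the costs.\<close>

lemma infsum_ennreal_eq:
  assumes "(f has_sum s) A" and nonneg: "\<And>x. x \<in> A \<Longrightarrow> f x \<ge> 0"
  shows "infsum (\<lambda>x. ennreal (f x)) A = ennreal s"
proof (rule infsumI)
  have "((\<lambda>F. ennreal (sum f F)) \<longlongrightarrow> ennreal s) (finite_subsets_at_top A)"
    using assms(1) unfolding has_sum_def by (rule tendsto_ennrealI)
  moreover have "\<forall>\<^sub>F F in finite_subsets_at_top A.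
      ennreal (sum f F) = (\<Sum>x\<in>F. ennreal (f x))"
    by (rule eventually_finite_subsets_at_top_weakI) (use nonneg in \<open>auto intro!: sum_ennreal[symmetric]\<close>)
  ultimately show "((\<lambda>x. ennreal (f x)) has_sum ennreal s) A"
    unfolding has_sum_def by (rule Lim_transform_eventually)
qed

text \<open>A nonzero \<open>d n\<close> would be multiplied by \<open>k ^ m\<close> after
  \<open>m\<close> steps and so exceed any bound.\<close>

lemma bounded_geometric_growth_zero:
  fixes d :: "nat \<Rightarrow> real"
  assumes "k > 1" and step: "\<And>n. d (Suc n) = k * d n" and bound: "\<And>n. \<bar>d n\<bar> \<le> C"
  shows "d n = 0"
proof (rule ccontr)
  assume "d n \<noteq> 0"
  have pow: "d (n + m) = k ^ m * d n" for m
    by (induction m) (simp_all add: step)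
  obtain m where "C / \<bar>d n\<bar> < k ^ m"
    using real_arch_pow[OF \<open>k > 1\<close>] by blast
  then have "C < \<bar>d (n + m)\<bar>"
    using \<open>d n \<noteq> 0\<close> \<open>k > 1\<close> by (simp add: pow abs_mult divide_less_eq)
  then show False
    using bound[of "n + m"] by simp
qed

text \<open>Both total masses are 1, which forces \<open>k = 1\<close>.\<close>

lemma pmf_eq_if_proportional:
  assumes "\<And>x. pmf p x = k * pmf q x"
  shows "p = q"
proof -
  \<comment> \<open>A point of positive mass shows that \<open>k\<close> is nonnegative, so it can
    be pulled out of the integral as \<open>ennreal k\<close>.\<close>
  obtain x0 where "pmf p x0 > 0"
    by (metis pmf_positive set_pmf_not_empty ex_in_conv)
  then have "k \<ge> 0"
    using assms[of x0] pmf_nonneg[of q x0] by (metis not_le mult_nonpos_nonneg less_le_not_le order_less_imp_le)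
  have "(\<integral>\<^sup>+x. ennreal (pmf p x) \<partial>count_space UNIV) =
      ennreal k * (\<integral>\<^sup>+x. ennreal (pmf q x) \<partial>count_space UNIV)"
    using \<open>k \<ge> 0\<close> by (simp add: assms ennreal_mult nn_integral_cmult)
  then have "ennreal k = 1"
    by (simp add: nn_integral_pmf emeasure_pmf_UNIV)
  then show ?thesis
    using assms by (intro pmf_eqI) simp
qed

text \<open>The second derivative of the geometric series has coefficients
  \<open>(n + 1) * (n + 2)\<close>, which dominate the squares.\<close>

lemma summable_square_times_geometric:
  fixes r :: real
  assumes "\<bar>r\<bar> < 1"
  shows "summable (\<lambda>n. (real n)\<^sup>2 * r ^ n)"
proof -
  define s where "s = \<bar>r\<bar>"
  have s: "0 \<le> s" "s < 1" using assms by (auto simp: s_def)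
  \<comment> \<open>Stated on the whole open unit disc, because differentiating a second time at
    \<open>s\<close> requires convergence throughout the disc.\<close>
  have 1: "summable (\<lambda>n. diffs (\<lambda>_. 1) n * x ^ n)" if "norm x < 1" for x :: real
    by (rule termdiff_converges[of _ 1]) (use that in \<open>auto intro: summable_geometric\<close>)
  have 2: "summable (\<lambda>n. diffs (diffs (\<lambda>_. 1)) n * s ^ n)"
    by (rule termdiff_converges[of _ 1]) (use s 1 in auto)
  show ?thesis
  proof (rule summable_comparison_test'[OF 2])
    fix n :: nat
    have "(real n)\<^sup>2 \<le> diffs (diffs (\<lambda>_. 1)) n"
      by (simp add: diffs_def power2_eq_square algebra_simps)
    then show "norm ((real n)\<^sup>2 * r ^ n) \<le> diffs (diffs (\<lambda>_. 1)) n * s ^ n"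
      by (simp add: abs_mult power_abs s_def mult_right_mono)
  qed
qed

section \<open>States with a single lounge place\<close>

lemma lounge_states_1: "lounge_states 1 = range (\<lambda>n. (n, 0)) \<union> range (\<lambda>n. (Suc n, 1))"
proof -
  have "s \<in> lounge_states 1 \<longleftrightarrow> s \<in> range (\<lambda>n. (n, 0)) \<union> range (\<lambda>n. (Suc n, 1))" for s
    by (cases s; cases "fst s"; cases "snd s") (auto simp: lounge_states_def image_iff)
  then show ?thesis by blast
qed

text \<open>The five cases are the shapes of states at which the balance equation takes different
  forms.\<close>

lemma all_lounge_states_1:
  "(\<forall>s\<in>lounge_states 1. P s) \<longleftrightarrow>
     P (0,0) \<and> P (1,0) \<and> (\<forall>n. P (n+2,0)) \<and> P (1,1) \<and> (\<forall>n. P (n+2,1))"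
proof -
  have split: "(\<forall>n. Q n) \<longleftrightarrow> Q 0 \<and> (\<forall>n. Q (Suc n))" for Q :: "nat \<Rightarrow> bool"
    by (metis not0_implies_Suc)
  have "(\<forall>n. P (n, 0)) \<longleftrightarrow> P (0,0) \<and> P (1,0) \<and> (\<forall>n. P (n+2,0))"
    by (subst split, subst split) simp
  moreover have "(\<forall>n. P (Suc n, 1)) \<longleftrightarrow> P (1,1) \<and> (\<forall>n. P (n+2,1))"
    by (subst split) simp
  ultimately show ?thesis
    unfolding lounge_states_1 by (auto simp only: ball_Un ball_simps)
qed

lemma has_sum_lounge_states_1:
  fixes f :: "nat \<times> nat \<Rightarrow> real"
  assumes "((\<lambda>n. f (n, 0)) has_sum s) UNIV" "((\<lambda>n. f (Suc n, 1)) has_sum t) UNIV"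
  shows "(f has_sum (s + t)) (lounge_states 1)"
  unfolding lounge_states_1
proof (rule has_sum_Un_disjoint)
  show "(f has_sum s) (range (\<lambda>n. (n, 0)))"
    by (subst has_sum_reindex) (use assms(1) in \<open>auto simp: inj_on_def o_def\<close>)
  show "(f has_sum t) (range (\<lambda>n. (Suc n, 1)))"
    by (subst has_sum_reindex) (use assms(2) in \<open>auto simp: inj_on_def o_def\<close>)
qed auto

section \<open>Balance equations for \<open>A = 0\<close> and \<open>B = 1\<close>\<close>

text \<open>The arrival rate is given as a product, so that rewriting with \<open>lam_eq\<close>
  yields polynomials in \<rho> instead of quotients.\<close>

locale single_place_lounge =
  fixes lam \<mu> \<nu> \<rho> :: real
  assumes \<mu>_pos: "\<mu> > 0" and \<nu>_pos: "\<nu> > 0" and \<rho>_pos: "\<rho> > 0" and \<rho>_less_1: "\<rho> < 1"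
    and lam_eq: "lam = \<mu> * \<rho>"
begin

text \<open>The finite sets in the proof list the targets and the sources of jumps at the state; the
  other four shapes follow the same scheme. An arrival at the empty system joins the queue, since
  \<open>x > A\<close> fails for \<open>x = 0\<close>.\<close>

lemma balance_empty:
  "pmf p (0,0) * (\<Sum>\<^sub>\<infinity>t\<in>lounge_states 1. lounge_rate lam \<mu> \<nu> 0 1 (0,0) t) =
     (\<Sum>\<^sub>\<infinity>t\<in>lounge_states 1. pmf p t * lounge_rate lam \<mu> \<nu> 0 1 t (0,0)) \<longleftrightarrow>
   lam * pmf p (0,0) = \<mu> * pmf p (1,0)"
proof -
  have "(\<Sum>\<^sub>\<infinity>t\<in>lounge_states 1. lounge_rate lam \<mu> \<nu> 0 1 (0,0) t) =
      (\<Sum>t\<in>{(1,0)}. lounge_rate lam \<mu> \<nu> 0 1 (0,0) t)"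
    by (rule infsum_eq_sum_support) (auto simp: lounge_states_def le_Suc_eq split: if_splits)
  moreover have "(\<Sum>\<^sub>\<infinity>t\<in>lounge_states 1. pmf p t * lounge_rate lam \<mu> \<nu> 0 1 t (0,0)) =
      (\<Sum>t\<in>{(1,0)}. pmf p t * lounge_rate lam \<mu> \<nu> 0 1 t (0,0))"
    by (rule infsum_eq_sum_support) (auto simp: lounge_states_def le_Suc_eq split: if_splits)
  ultimately show ?thesis by (auto simp: mult.commute)
qed

text \<open>A service at \<open>(1,1)\<close> leads here because the lounge customer fills the
  emptied queue at once. No lounge transfer does: it would start in \<open>(0,1)\<close>, which is
  not a state.\<close>

lemma balance_queue_1:
  "pmf p (1,0) * (\<Sum>\<^sub>\<infinity>t\<in>lounge_states 1. lounge_rate lam \<mu> \<nu> 0 1 (1,0) t) =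
     (\<Sum>\<^sub>\<infinity>t\<in>lounge_states 1. pmf p t * lounge_rate lam \<mu> \<nu> 0 1 t (1,0)) \<longleftrightarrow>
   (lam + \<mu>) * pmf p (1,0) = lam * pmf p (0,0) + \<mu> * pmf p (2,0) + \<mu> * pmf p (1,1)"
proof -
  have "(\<Sum>\<^sub>\<infinity>t\<in>lounge_states 1. lounge_rate lam \<mu> \<nu> 0 1 (1,0) t) =
      (\<Sum>t\<in>{(1,1),(0,0)}. lounge_rate lam \<mu> \<nu> 0 1 (1,0) t)"
    by (rule infsum_eq_sum_support) (auto simp: lounge_states_def le_Suc_eq split: if_splits)
  moreover have "(\<Sum>\<^sub>\<infinity>t\<in>lounge_states 1. pmf p t * lounge_rate lam \<mu> \<nu> 0 1 t (1,0)) =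
      (\<Sum>t\<in>{(0,0),(2,0),(1,1)}. pmf p t * lounge_rate lam \<mu> \<nu> 0 1 t (1,0))"
    by (rule infsum_eq_sum_support) (auto simp: lounge_states_def le_Suc_eq split: if_splits)
  ultimately show ?thesis by (auto simp: algebra_simps)
qed

text \<open>No arrival leads here, since an arrival at \<open>(n+1,0)\<close> takes the free lounge
  place.\<close>

lemma balance_queue:
  "pmf p (n+2,0) * (\<Sum>\<^sub>\<infinity>t\<in>lounge_states 1. lounge_rate lam \<mu> \<nu> 0 1 (n+2,0) t) =
     (\<Sum>\<^sub>\<infinity>t\<in>lounge_states 1. pmf p t * lounge_rate lam \<mu> \<nu> 0 1 t (n+2,0)) \<longleftrightarrow>
   (lam + \<mu>) * pmf p (n+2,0) = \<mu> * pmf p (n+3,0) + \<nu> * pmf p (n+1,1)"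
proof -
  have "(\<Sum>\<^sub>\<infinity>t\<in>lounge_states 1. lounge_rate lam \<mu> \<nu> 0 1 (n+2,0) t) =
      (\<Sum>t\<in>{(n+2,1),(n+1,0)}. lounge_rate lam \<mu> \<nu> 0 1 (n+2,0) t)"
    by (rule infsum_eq_sum_support) (auto simp: lounge_states_def le_Suc_eq split: if_splits)
  moreover have "(\<Sum>\<^sub>\<infinity>t\<in>lounge_states 1. pmf p t * lounge_rate lam \<mu> \<nu> 0 1 t (n+2,0)) =
      (\<Sum>t\<in>{(n+3,0),(n+1,1)}. pmf p t * lounge_rate lam \<mu> \<nu> 0 1 t (n+2,0))"
    by (rule infsum_eq_sum_support) (auto simp: lounge_states_def le_Suc_eq split: if_splits)
  ultimately show ?thesis by (auto simp: algebra_simps)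
qed

lemma balance_lounge_1:
  "pmf p (1,1) * (\<Sum>\<^sub>\<infinity>t\<in>lounge_states 1. lounge_rate lam \<mu> \<nu> 0 1 (1,1) t) =
     (\<Sum>\<^sub>\<infinity>t\<in>lounge_states 1. pmf p t * lounge_rate lam \<mu> \<nu> 0 1 t (1,1)) \<longleftrightarrow>
   (lam + \<mu> + \<nu>) * pmf p (1,1) = lam * pmf p (1,0) + \<mu> * pmf p (2,1)"
proof -
  have "(\<Sum>\<^sub>\<infinity>t\<in>lounge_states 1. lounge_rate lam \<mu> \<nu> 0 1 (1,1) t) =
      (\<Sum>t\<in>{(2,1),(1,0),(2,0)}. lounge_rate lam \<mu> \<nu> 0 1 (1,1) t)"
    by (rule infsum_eq_sum_support) (auto simp: lounge_states_def le_Suc_eq split: if_splits)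
  moreover have "(\<Sum>\<^sub>\<infinity>t\<in>lounge_states 1. pmf p t * lounge_rate lam \<mu> \<nu> 0 1 t (1,1)) =
      (\<Sum>t\<in>{(1,0),(2,1)}. pmf p t * lounge_rate lam \<mu> \<nu> 0 1 t (1,1))"
    by (rule infsum_eq_sum_support) (auto simp: lounge_states_def le_Suc_eq split: if_splits)
  ultimately show ?thesis by (auto simp: algebra_simps)
qed

text \<open>Arrivals lead here in two ways: at \<open>(n+2,0)\<close> into the free lounge place, at
  \<open>(n+1,1)\<close> into the queue because the lounge is full.\<close>

lemma balance_lounge:
  "pmf p (n+2,1) * (\<Sum>\<^sub>\<infinity>t\<in>lounge_states 1. lounge_rate lam \<mu> \<nu> 0 1 (n+2,1) t) =
     (\<Sum>\<^sub>\<infinity>t\<in>lounge_states 1. pmf p t * lounge_rate lam \<mu> \<nu> 0 1 t (n+2,1)) \<longleftrightarrow>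
   (lam + \<mu> + \<nu>) * pmf p (n+2,1) =
     lam * pmf p (n+2,0) + lam * pmf p (n+1,1) + \<mu> * pmf p (n+3,1)"
proof -
  have "(\<Sum>\<^sub>\<infinity>t\<in>lounge_states 1. lounge_rate lam \<mu> \<nu> 0 1 (n+2,1) t) =
      (\<Sum>t\<in>{(n+3,1),(n+1,1),(n+3,0)}. lounge_rate lam \<mu> \<nu> 0 1 (n+2,1) t)"
    by (rule infsum_eq_sum_support) (auto simp: lounge_states_def le_Suc_eq split: if_splits)
  moreover have "(\<Sum>\<^sub>\<infinity>t\<in>lounge_states 1. pmf p t * lounge_rate lam \<mu> \<nu> 0 1 t (n+2,1)) =
      (\<Sum>t\<in>{(n+2,0),(n+1,1),(n+3,1)}. pmf p t * lounge_rate lam \<mu> \<nu> 0 1 t (n+2,1))"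
    by (rule infsum_eq_sum_support) (auto simp: lounge_states_def le_Suc_eq split: if_splits)
  ultimately show ?thesis by (auto simp: algebra_simps)
qed

lemma stationary_iff:
  "stationary_distribution (lounge_states 1) (lounge_rate lam \<mu> \<nu> 0 1) p \<longleftrightarrow>
     set_pmf p \<subseteq> lounge_states 1 \<and>
     lam * pmf p (0,0) = \<mu> * pmf p (1,0) \<and>
     (lam + \<mu>) * pmf p (1,0) = lam * pmf p (0,0) + \<mu> * pmf p (2,0) + \<mu> * pmf p (1,1) \<and>
     (\<forall>n. (lam + \<mu>) * pmf p (n+2,0) = \<mu> * pmf p (n+3,0) + \<nu> * pmf p (n+1,1)) \<and>
     (lam + \<mu> + \<nu>) * pmf p (1,1) = lam * pmf p (1,0) + \<mu> * pmf p (2,1) \<and>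
     (\<forall>n. (lam + \<mu> + \<nu>) * pmf p (n+2,1) =
        lam * pmf p (n+2,0) + lam * pmf p (n+1,1) + \<mu> * pmf p (n+3,1))"
  unfolding stationary_distribution_def all_lounge_states_1
    balance_empty balance_queue_1 balance_queue balance_lounge_1 balance_lounge ..

section \<open>The form of every stationary distribution\<close>

text \<open>The balance equations leave only \<open>pmf p (0,0)\<close> free, which is what
  uniqueness needs. The totals come from flows across cuts, the lounge values from a recursion with
  a single bounded solution.\<close>

lemma lounge_geometric:
  assumes "stationary_distribution (lounge_states 1) (lounge_rate lam \<mu> \<nu> 0 1) p"
  shows "pmf p (Suc n, 1) = lam / (\<mu> + \<nu>) * pmf p (0,0) * \<rho> ^ Suc n"
    and "pmf p (Suc (Suc n), 0) + pmf p (Suc n, 1) = pmf p (0,0) * \<rho> ^ Suc (Suc n)"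
    and "pmf p (1,0) = pmf p (0,0) * \<rho>"
proof -
  \<comment> \<open>Index shift: \<open>b m\<close> belongs to the state \<open>(m+1,1)\<close> with
    \<open>m+2\<close> customers, so \<open>N\<close> pairs it with \<open>a (m+2)\<close>.\<close>
  define a b N where "a = (\<lambda>n. pmf p (n,0))" and "b = (\<lambda>n. pmf p (Suc n,1))"
    and "N = (\<lambda>n. case n of Suc (Suc m) \<Rightarrow> a n + b m | _ \<Rightarrow> a n)"
  have e0: "lam * a 0 = \<mu> * a 1"
    and e1: "(lam + \<mu>) * a 1 = lam * a 0 + \<mu> * a 2 + \<mu> * b 0"
    and e2: "(lam + \<mu>) * a (n+2) = \<mu> * a (n+3) + \<nu> * b n"
    and e3: "(lam + \<mu> + \<nu>) * b 0 = lam * a 1 + \<mu> * b 1"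
    and e4: "(lam + \<mu> + \<nu>) * b (n+1) = lam * a (n+2) + lam * b n + \<mu> * b (n+2)" for n
    using assms unfolding stationary_iff by (auto simp: a_def b_def numeral_eq_Suc)
  \<comment> \<open>\<open>N n\<close> is the probability of \<open>n\<close> customers in total.\<close>
  have cut: "lam * N n = \<mu> * N (Suc n)" for n
  proof (induction n rule: less_induct)
    case (less n)
    \<comment> \<open>Adding the balance equations of all states with \<open>n\<close> customers
      cancels the \<nu> terms, since transfers preserve the total. Subtracting the cut equation at
      \<open>n - 1\<close> leaves the one at \<open>n\<close>. The small cases use the boundary
      equations.\<close>
    consider "n = 0" | "n = 1" | "n = 2" | m where "n = m + 3"
      by (metis One_nat_def Suc_1 add_2_eq_Suc' add_Suc_right not0_implies_Suc numeral_3_eq_3 eval_nat_numeral(3) Suc_eq_plus1)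
    then show ?case
    proof cases
      case 1
      then show ?thesis using e0 by (simp add: N_def)
    next
      case 2
      then show ?thesis using e0 e1 by (simp add: N_def numeral_eq_Suc algebra_simps)
    next
      case 3
      then show ?thesis using less[of 1] e2[of 0] e3
        by (simp add: N_def numeral_eq_Suc algebra_simps)
    next
      case 4
      then show ?thesis using less[of "m+2"] e2[of "m+1"] e4[of m]
        by (simp add: N_def numeral_eq_Suc algebra_simps)
    qed
  qed
  have N: "N n = a 0 * \<rho> ^ n" for n
  proof (induction n)
    case (Suc n)
    have "N (Suc n) = \<rho> * N n"
      using cut[of n] \<mu>_pos by (simp add: lam_eq field_simps)
    then show ?case using Suc by simp
  qed (simp add: N_def)
  \<comment> \<open>Chosen so that \<open>c * \<rho> ^ Suc n\<close> is a particular solution of the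
    recursion \<open>b_step\<close>; \<open>d\<close> below is the deviation from it.\<close>
  define c where "c = lam / (\<mu> + \<nu>) * a 0"
  have c: "c * (\<mu> + \<nu>) = lam * a 0"
    using \<mu>_pos \<nu>_pos by (simp add: c_def)
  define d where "d = (\<lambda>n. b n - c * \<rho> ^ Suc n)"
  \<comment> \<open>The arrivals into \<open>(n+1,1)\<close> come from all states with
    \<open>n+1\<close> customers, whose total mass is already known.\<close>
  have b_step: "(lam + \<mu> + \<nu>) * b n = lam * (a 0 * \<rho> ^ Suc n) + \<mu> * b (Suc n)" for n
  proof (cases n)
    case 0
    then show ?thesis using e3 N[of 1] by (simp add: N_def)
  next
    case (Suc m)
    have "lam * (a (Suc (Suc m)) + b m) = lam * (a 0 * \<rho> ^ Suc (Suc m))"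
      using N[of "Suc (Suc m)"] by (simp add: N_def)
    then show ?thesis using e4[of m] Suc by (simp add: algebra_simps)
  qed
  have d_step: "d (Suc n) = (lam + \<mu> + \<nu>) / \<mu> * d n" for n
  proof -
    have "lam * (a 0 * \<rho> ^ Suc n) = (lam + \<mu> + \<nu>) * (c * \<rho> ^ Suc n) - \<mu> * (c * \<rho> ^ Suc (Suc n))"
    proof -
      have "lam * (a 0 * \<rho> ^ Suc n) = (c * (\<mu> + \<nu>)) * \<rho> ^ Suc n" by (simp add: c)
      then show ?thesis by (simp add: lam_eq algebra_simps)
    qed
    then have "\<mu> * d (Suc n) = (lam + \<mu> + \<nu>) * d n"
      using b_step[of n] unfolding d_def by (simp only: right_diff_distrib)
    then show ?thesis using \<mu>_pos by (simp add: field_simps)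
  qed
  \<comment> \<open>The deviation solves the homogeneous recursion, with ratio above 1, yet is
    bounded since probabilities are.\<close>
  have "d n = 0" for n
  proof (rule bounded_geometric_growth_zero[where d = d, OF _ d_step])
    show "(lam + \<mu> + \<nu>) / \<mu> > 1" using \<rho>_pos \<mu>_pos \<nu>_pos by (simp add: lam_eq add_pos_pos)
    fix n
    have "\<bar>b n\<bar> \<le> 1" by (simp add: b_def pmf_le_1)
    moreover have "\<bar>c * \<rho> ^ Suc n\<bar> \<le> \<bar>c\<bar>"
      using \<rho>_pos \<rho>_less_1 power_le_one[of \<rho> "Suc n"]
      by (simp only: abs_mult) (intro mult_left_le, simp_all)
    ultimately show "\<bar>d n\<bar> \<le> 1 + \<bar>c\<bar>" unfolding d_def by linarith
  qed
  then show "pmf p (Suc n, 1) = lam / (\<mu> + \<nu>) * pmf p (0,0) * \<rho> ^ Suc n"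
    by (simp add: d_def b_def c_def a_def)
  show "pmf p (Suc (Suc n), 0) + pmf p (Suc n, 1) = pmf p (0,0) * \<rho> ^ Suc (Suc n)"
    using N[of "Suc (Suc n)"] by (simp add: N_def a_def b_def)
  show "pmf p (1,0) = pmf p (0,0) * \<rho>"
    using N[of 1] by (simp add: N_def a_def)
qed

section \<open>The explicit stationary distribution and its uniqueness\<close>

text \<open>
  The total number of customers is geometric, as in the queue without lounge; given that it is at
  least 2, the lounge is occupied with probability \<open>\<mu> / (\<mu> + \<nu>)\<close>.
\<close>

definition lounge_dist :: "(nat \<times> nat) pmf" where
  "lounge_dist =
     map_pmf (\<lambda>(n, occupied). if occupied \<and> n \<ge> 2 then (n - 1, 1) else (n, 0))
       (pair_pmf (geometric_pmf (1 - \<rho>)) (bernoulli_pmf (\<mu> / (\<mu> + \<nu>))))"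

text \<open>Sum the product weights over the fibres of \<open>h\<close>. For totals 0 and 1 both
  values of \<open>occupied\<close> give the same state and their weights add up; all other fibres
  are single points.\<close>

lemma
  shows pmf_lounge_dist_0: "pmf lounge_dist (0,0) = 1 - \<rho>"
    and pmf_lounge_dist_1: "pmf lounge_dist (1,0) = (1 - \<rho>) * \<rho>"
    and pmf_lounge_dist_queue:
      "pmf lounge_dist (n+2,0) = (1 - \<rho>) * \<rho> ^ (n+2) * (\<nu> / (\<mu> + \<nu>))"
    and pmf_lounge_dist_lounge:
      "pmf lounge_dist (n+1,1) = (1 - \<rho>) * \<rho> ^ (n+2) * (\<mu> / (\<mu> + \<nu>))"
proof -
  define M where "M = pair_pmf (geometric_pmf (1 - \<rho>)) (bernoulli_pmf (\<mu> / (\<mu> + \<nu>)))"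
  define h :: "nat \<times> bool \<Rightarrow> nat \<times> nat"
    where "h = (\<lambda>(n, occupied). if occupied \<and> n \<ge> 2 then (n - 1, 1) else (n, 0))"
  have q: "0 \<le> \<mu> / (\<mu> + \<nu>)" "\<mu> / (\<mu> + \<nu>) \<le> 1" "1 - \<mu> / (\<mu> + \<nu>) = \<nu> / (\<mu> + \<nu>)"
    using \<mu>_pos \<nu>_pos by (auto simp: field_simps)
  have M: "pmf M (n, True) = (1 - \<rho>) * \<rho> ^ n * (\<mu> / (\<mu> + \<nu>))"
    "pmf M (n, False) = (1 - \<rho>) * \<rho> ^ n * (\<nu> / (\<mu> + \<nu>))" for n
    using \<rho>_pos \<rho>_less_1 q by (simp_all add: M_def pmf_pair)
  have L: "pmf lounge_dist s = (\<Sum>x\<in>T. pmf M x)" if "h -` {s} = T" "finite T" for s T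
    using that by (simp add: lounge_dist_def pmf_map measure_measure_pmf_finite
        flip: M_def h_def)
  have both: "x * (\<mu> / (\<mu> + \<nu>)) + x * (\<nu> / (\<mu> + \<nu>)) = x" for x
    using \<mu>_pos \<nu>_pos by (simp flip: distrib_left add_divide_distrib)
  have "pmf lounge_dist (0,0) = (\<Sum>x\<in>{(0,True),(0,False)}. pmf M x)"
    by (rule L) (auto simp: h_def split: if_splits)
  also have "\<dots> = 1 - \<rho>" using both[of "1 - \<rho>"] by (simp add: M)
  finally show "pmf lounge_dist (0,0) = 1 - \<rho>" .
  have "pmf lounge_dist (1,0) = (\<Sum>x\<in>{(1,True),(1,False)}. pmf M x)"
    by (rule L) (auto simp: h_def split: if_splits)
  also have "\<dots> = (1 - \<rho>) * \<rho>" using both[of "(1 - \<rho>) * \<rho>"] by (simp add: M)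
  finally show "pmf lounge_dist (1,0) = (1 - \<rho>) * \<rho>" .
  have "pmf lounge_dist (n+2,0) = (\<Sum>x\<in>{(n+2,False)}. pmf M x)"
    by (rule L) (auto simp: h_def split: if_splits)
  then show "pmf lounge_dist (n+2,0) = (1 - \<rho>) * \<rho> ^ (n+2) * (\<nu> / (\<mu> + \<nu>))"
    by (simp add: M)
  have "pmf lounge_dist (n+1,1) = (\<Sum>x\<in>{(n+2,True)}. pmf M x)"
    by (rule L) (auto simp: h_def split: if_splits)
  then show "pmf lounge_dist (n+1,1) = (1 - \<rho>) * \<rho> ^ (n+2) * (\<mu> / (\<mu> + \<nu>))"
    by (simp add: M)
qed

lemma stationary_lounge_dist:
  "stationary_distribution (lounge_states 1) (lounge_rate lam \<mu> \<nu> 0 1) lounge_dist"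
  unfolding stationary_iff
proof (intro conjI allI)
  show "set_pmf lounge_dist \<subseteq> lounge_states 1"
    by (auto simp: lounge_dist_def lounge_states_def split: if_splits)
  \<comment> \<open>Factoring out \<open>w\<close> clears the denominator
    \<open>\<mu> + \<nu>\<close>, so each balance equation becomes a polynomial identity.\<close>
  define w where "w = (1 - \<rho>) / (\<mu> + \<nu>)"
  have w: "1 - \<rho> = w * (\<mu> + \<nu>)"
    using \<mu>_pos \<nu>_pos by (simp add: w_def)
  have queue_0: "pmf lounge_dist (0,0) = w * (\<mu> + \<nu>)"
    and queue_1: "pmf lounge_dist (1,0) = w * (\<mu> + \<nu>) * \<rho>"
    unfolding pmf_lounge_dist_0 pmf_lounge_dist_1 w by simp_all
  have queue: "pmf lounge_dist (n+2,0) = w * \<nu> * \<rho> ^ (n+2)"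
    and lounge: "pmf lounge_dist (n+1,1) = w * \<mu> * \<rho> ^ (n+2)" for n
    unfolding pmf_lounge_dist_queue pmf_lounge_dist_lounge by (simp_all add: w_def)
  have queue_2: "pmf lounge_dist (2,0) = w * \<nu> * \<rho> ^ 2"
    and lounge_1: "pmf lounge_dist (1,1) = w * \<mu> * \<rho> ^ 2"
    and lounge_2: "pmf lounge_dist (2,1) = w * \<mu> * \<rho> ^ 3"
    using queue[of 0] lounge[of 0] lounge[of 1] by (simp_all add: numeral_eq_Suc)
  note poly = lam_eq power2_eq_square power3_eq_cube
  show "lam * pmf lounge_dist (0,0) = \<mu> * pmf lounge_dist (1,0)"
    unfolding queue_0 queue_1 by (simp add: poly)
  show "(lam + \<mu>) * pmf lounge_dist (1,0) =
      lam * pmf lounge_dist (0,0) + \<mu> * pmf lounge_dist (2,0) + \<mu> * pmf lounge_dist (1,1)"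
    unfolding queue_0 queue_1 queue_2 lounge_1 by (simp add: poly algebra_simps)
  show "(lam + \<mu> + \<nu>) * pmf lounge_dist (1,1) =
      lam * pmf lounge_dist (1,0) + \<mu> * pmf lounge_dist (2,1)"
    unfolding queue_1 lounge_1 lounge_2 by (simp add: poly algebra_simps)
  fix n
  have next_queue: "pmf lounge_dist (n+3,0) = w * \<nu> * \<rho> ^ (n+3)"
    and next_lounge: "pmf lounge_dist (n+2,1) = w * \<mu> * \<rho> ^ (n+3)"
      "pmf lounge_dist (n+3,1) = w * \<mu> * \<rho> ^ (n+4)"
    using queue[of "n+1"] lounge[of "n+1"] lounge[of "n+2"] by (simp_all add: numeral_eq_Suc)
  show "(lam + \<mu>) * pmf lounge_dist (n+2,0) =
      \<mu> * pmf lounge_dist (n+3,0) + \<nu> * pmf lounge_dist (n+1,1)"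
    unfolding queue lounge next_queue by (simp add: lam_eq numeral_eq_Suc algebra_simps)
  show "(lam + \<mu> + \<nu>) * pmf lounge_dist (n+2,1) =
      lam * pmf lounge_dist (n+2,0) + lam * pmf lounge_dist (n+1,1) + \<mu> * pmf lounge_dist (n+3,1)"
    unfolding queue lounge next_lounge by (simp add: lam_eq numeral_eq_Suc algebra_simps)
qed

text \<open>By \<open>lounge_geometric\<close>, both distributions are determined by their values at
  \<open>(0,0)\<close> through the same formulas, so they are proportional.\<close>

lemma stationary_unique:
  assumes "stationary_distribution (lounge_states 1) (lounge_rate lam \<mu> \<nu> 0 1) p"
  shows "p = lounge_dist"
proof (rule pmf_eq_if_proportional)
  define k where "k = pmf p (0,0) / (1 - \<rho>)"
  have k: "pmf p (0,0) = k * pmf lounge_dist (0,0)"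
    using \<rho>_less_1 by (simp add: k_def pmf_lounge_dist_0)
  note P = lounge_geometric[OF assms] and Q = lounge_geometric[OF stationary_lounge_dist]
  fix s
  have "\<forall>s\<in>lounge_states 1. pmf p s = k * pmf lounge_dist s"
    unfolding all_lounge_states_1
  proof (intro conjI allI)
    show "pmf p (0,0) = k * pmf lounge_dist (0,0)" by (rule k)
    show "pmf p (1,0) = k * pmf lounge_dist (1,0)" using P(3) Q(3) k by simp
    have lounge: "pmf p (Suc n,1) = k * pmf lounge_dist (Suc n,1)" for n
      unfolding P(1)[of n] Q(1)[of n] k by simp
    from lounge[of 0] show "pmf p (1,1) = k * pmf lounge_dist (1,1)" by simp
    fix n
    from lounge[of "Suc n"] show "pmf p (n+2,1) = k * pmf lounge_dist (n+2,1)" by simp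
    have "pmf p (Suc (Suc n),0) + pmf p (Suc n,1) =
        k * (pmf lounge_dist (Suc (Suc n),0) + pmf lounge_dist (Suc n,1))"
      unfolding P(2)[of n] Q(2)[of n] k by simp
    with lounge[of n] show "pmf p (n+2,0) = k * pmf lounge_dist (n+2,0)"
      by (simp add: distrib_left)
  qed
  moreover have "pmf p s = 0" "pmf lounge_dist s = 0" if "s \<notin> lounge_states 1"
    using that assms stationary_lounge_dist
    by (auto simp: stationary_distribution_def set_pmf_iff)
  ultimately show "pmf p s = k * pmf lounge_dist s" by (cases "s \<in> lounge_states 1") auto
qed

lemma lounge_stationary_eq:
  assumes "lounge_capacity lam \<mu> \<nu> 0 = 1"
  shows "lounge_stationary lam \<mu> \<nu> 0 = lounge_dist"
  unfolding lounge_stationary_def assms Let_def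
  using stationary_lounge_dist stationary_unique by (rule the_equality)

section \<open>Comparison of the two costs\<close>

text \<open>Real representatives show that both costs are finite and give a signed difference, which
  truncated subtraction in \<open>ennreal\<close> would lose.\<close>

lemma cost_difference:
  assumes cap: "lounge_capacity lam \<mu> \<nu> 0 = 1" and "\<omega> > 0"
  obtains g g\<^sub>o where "lounge_cost lam \<mu> \<nu> \<omega> 0 = ennreal g" "no_lounge_cost lam \<mu> = ennreal g\<^sub>o"
    "g\<^sub>o - g = \<rho>\<^sup>2 * (\<mu> / (\<mu> + \<nu>)) * ((3 - \<rho>) / (1 - \<rho>) - \<omega>)"
proof -
  define a b where "a = (\<lambda>n. pmf lounge_dist (n,0))" and "b = (\<lambda>n. pmf lounge_dist (Suc n,1))"
  define \<beta> where "\<beta> = \<mu> / (\<mu> + \<nu>)"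
  have b: "b n = (1 - \<rho>) * \<rho>\<^sup>2 * \<beta> * \<rho> ^ n" for n
    using pmf_lounge_dist_lounge[of n] by (simp add: b_def \<beta>_def power_add power2_eq_square ac_simps)
  have ab: "(1 - \<rho>) * \<rho> ^ Suc (Suc n) = a (Suc (Suc n)) + b n" for n
    using lounge_geometric(2)[OF stationary_lounge_dist, of n]
    by (simp add: a_def b_def pmf_lounge_dist_0)
  \<comment> \<open>Domination by the geometric weights makes the empty-lounge part of the cost
    summable.\<close>
  have a_le: "a n \<le> (1 - \<rho>) * \<rho> ^ n" for n
  proof -
    consider "n = 0" | "n = 1" | m where "n = Suc (Suc m)"
      by (metis One_nat_def not0_implies_Suc)
    then show ?thesis
    proof cases
      case 1
      then show ?thesis by (simp add: a_def pmf_lounge_dist_0)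
    next
      case 2
      then show ?thesis using pmf_lounge_dist_1 by (simp add: a_def)
    next
      case 3
      have "b m \<ge> 0" by (simp add: b_def)
      then show ?thesis using ab[of m] 3 by simp
    qed
  qed
  have "summable (\<lambda>n. (real n)\<^sup>2 * \<rho> ^ n * (1 - \<rho>))"
    using \<rho>_pos \<rho>_less_1 by (intro summable_mult2 summable_square_times_geometric) auto
  then obtain g\<^sub>o where go: "(\<lambda>n. (real n)\<^sup>2 * \<rho> ^ n * (1 - \<rho>)) sums g\<^sub>o"
    by (auto simp: summable_def)
  have "summable (\<lambda>n. (real n)\<^sup>2 * a n)"
  proof (rule summable_comparison_test'[OF sums_summable[OF go]])
    fix n
    show "norm ((real n)\<^sup>2 * a n) \<le> (real n)\<^sup>2 * \<rho> ^ n * (1 - \<rho>)"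
      using mult_left_mono[OF a_le[of n], of "(real n)\<^sup>2"] by (simp add: a_def ac_simps)
  qed
  then obtain u where u: "(\<lambda>n. (real n)\<^sup>2 * a n) sums u"
    by (auto simp: summable_def)
  have "(\<lambda>n. (real n)\<^sup>2 * \<rho> ^ n * (1 - \<rho>) - (real n)\<^sup>2 * a n) sums (g\<^sub>o - u)"
    using go u by (rule sums_diff)
  \<comment> \<open>The first two terms vanish, as \<open>a\<close> agrees with the geometric
    weights at 0 and 1; from 2 on the gap is \<open>b\<close>.\<close>
  then have "(\<lambda>n. (real (n+2))\<^sup>2 * \<rho> ^ (n+2) * (1 - \<rho>) - (real (n+2))\<^sup>2 * a (n+2)) sums (g\<^sub>o - u)"
    by (subst (asm) sums_iff_shift'[of _ 2, symmetric])
       (use pmf_lounge_dist_1 in \<open>simp add: numeral_eq_Suc a_def\<close>)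
  moreover have "(real (n+2))\<^sup>2 * \<rho> ^ (n+2) * (1 - \<rho>) - (real (n+2))\<^sup>2 * a (n+2) =
      (real (n+2))\<^sup>2 * b n" for n
  proof -
    have "(real (n+2))\<^sup>2 * ((1 - \<rho>) * \<rho> ^ (n+2)) = (real (n+2))\<^sup>2 * (a (n+2) + b n)"
      using ab[of n] by simp
    then show ?thesis by (simp add: algebra_simps)
  qed
  ultimately have v: "(\<lambda>n. (real (n+2))\<^sup>2 * b n) sums (g\<^sub>o - u)" by simp
  \<comment> \<open>The cost saved by the lounge. Since
    \<open>(n+2)^2 - (n+1)^2 = 2 * (n+1) + 1\<close>, its series combines the geometric series with
    its derivative.\<close>
  define D where "D = \<rho>\<^sup>2 * \<beta> * ((3 - \<rho>) / (1 - \<rho>) - \<omega>)"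
  have "(\<lambda>n. (1 - \<rho>) * \<rho>\<^sup>2 * \<beta> * (2 * (of_nat (Suc n) * \<rho> ^ n) + (1 - \<omega>) * \<rho> ^ n)) sums
      ((1 - \<rho>) * \<rho>\<^sup>2 * \<beta> * (2 * (1 / (1 - \<rho>)\<^sup>2) + (1 - \<omega>) * (1 / (1 - \<rho>))))"
    using \<rho>_pos \<rho>_less_1
    by (intro sums_mult sums_add geometric_deriv_sums geometric_sums) auto
  moreover have "(1 - \<rho>) * \<rho>\<^sup>2 * \<beta> * (2 * (1 / (1 - \<rho>)\<^sup>2) + (1 - \<omega>) * (1 / (1 - \<rho>))) = D"
  proof -
    have "(1 - \<rho>) * (2 * (1 / (1 - \<rho>)\<^sup>2) + (1 - \<omega>) * (1 / (1 - \<rho>))) = (3 - \<rho>) / (1 - \<rho>) - \<omega>"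
      using \<rho>_less_1 by (simp add: divide_simps power2_eq_square) (simp add: algebra_simps)
    from arg_cong[OF this, of "\<lambda>x. \<rho>\<^sup>2 * \<beta> * x"] show ?thesis
      unfolding D_def by (simp only: ac_simps)
  qed
  moreover have "(1 - \<rho>) * \<rho>\<^sup>2 * \<beta> * (2 * (of_nat (Suc n) * \<rho> ^ n) + (1 - \<omega>) * \<rho> ^ n) =
      (real (n+2))\<^sup>2 * b n - ((real (Suc n))\<^sup>2 + \<omega>) * b n" for n
    unfolding b by (simp add: algebra_simps power2_eq_square)
  ultimately have D: "(\<lambda>n. (real (n+2))\<^sup>2 * b n - ((real (Suc n))\<^sup>2 + \<omega>) * b n) sums D"
    by simp
  from sums_diff[OF v D] have w: "(\<lambda>n. ((real (Suc n))\<^sup>2 + \<omega>) * b n) sums (g\<^sub>o - u - D)"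
    by simp
  define f where "f = (\<lambda>(q, l). ((real q)\<^sup>2 + \<omega> * (real l)\<^sup>2) * pmf lounge_dist (q, l))"
  have f_nonneg: "f x \<ge> 0" for x
    using \<open>\<omega> > 0\<close> by (cases x) (simp add: f_def)
  have f: "(f has_sum (u + (g\<^sub>o - u - D))) (lounge_states 1)"
  proof (rule has_sum_lounge_states_1)
    show "((\<lambda>n. f (n, 0)) has_sum u) UNIV"
      by (rule sums_nonneg_imp_has_sum) (use u f_nonneg in \<open>auto simp: f_def a_def\<close>)
    show "((\<lambda>n. f (Suc n, 1)) has_sum (g\<^sub>o - u - D)) UNIV"
      by (rule sums_nonneg_imp_has_sum) (use w f_nonneg[of "(Suc n, 1)" for n] in \<open>auto simp: f_def b_def\<close>)
  qed
  then have f': "(f has_sum (g\<^sub>o - D)) (lounge_states 1)" by simp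
  have "lounge_cost lam \<mu> \<nu> \<omega> 0 = (\<Sum>\<^sub>\<infinity>x\<in>lounge_states 1. ennreal (f x))"
    unfolding lounge_cost_def lounge_stationary_eq[OF cap] cap
    by (intro infsum_cong) (auto simp: f_def)
  also have "\<dots> = ennreal (g\<^sub>o - D)"
    using f' f_nonneg by (intro infsum_ennreal_eq)
  finally have lounge: "lounge_cost lam \<mu> \<nu> \<omega> 0 = ennreal (g\<^sub>o - D)" .
  have go_nonneg: "(real n)\<^sup>2 * \<rho> ^ n * (1 - \<rho>) \<ge> 0" for n
    using \<rho>_pos \<rho>_less_1 by simp
  have "no_lounge_cost lam \<mu> = ennreal g\<^sub>o"
    using \<mu>_pos unfolding no_lounge_cost_def Let_def lam_eq
    by (simp, intro infsum_ennreal_eq sums_nonneg_imp_has_sum go go_nonneg)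
  with lounge show ?thesis
    by (intro that[of "g\<^sub>o - D" g\<^sub>o]) (auto simp: D_def \<beta>_def)
qed

end

section \<open>Reduction to one admissible parameter and choice by sign\<close>

theorem theorem2:
  fixes lam \<mu> \<nu> \<omega> \<rho> \<omega>_bar :: real
  assumes "lam > 0" and "\<mu> > 0" and "\<nu> > 0" and "\<omega> > 0"
    and "\<rho> = lam / \<mu>" and "\<rho> < 1"
    and "\<mu> - lam \<le> \<nu>"
    and "\<omega>_bar = (3 - \<rho>) / (1 - \<rho>)"
  shows "(\<omega> < \<omega>_bar \<longrightarrow>
            is_arg_min (lounge_cost lam \<mu> \<nu> \<omega>) (\<lambda>A. A \<in> customer_responses lam \<mu> \<nu>) 0 \<and>
            min (optimal_lounge_cost lam \<mu> \<nu> \<omega>) (no_lounge_cost lam \<mu>)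
              = optimal_lounge_cost lam \<mu> \<nu> \<omega> \<and>
            optimal_lounge_cost lam \<mu> \<nu> \<omega> = lounge_cost lam \<mu> \<nu> \<omega> 0) \<and>
         (\<omega> \<ge> \<omega>_bar \<longrightarrow>
            min (optimal_lounge_cost lam \<mu> \<nu> \<omega>) (no_lounge_cost lam \<mu>)
              = no_lounge_cost lam \<mu>)"
proof -
  have "lam < \<mu>" using assms(2,5,6) by (simp add: divide_less_eq)
  interpret single_place_lounge lam \<mu> \<nu> \<rho>
    using assms by unfold_locales auto
  have ratio: "0 < (\<mu> - lam) / \<nu>" "(\<mu> - lam) / \<nu> \<le> 1"
    using \<open>lam < \<mu>\<close> assms by auto
  \<comment> \<open>The ratio lies in the half-open interval from 0 (excluded) to 1 (included), so
    both ceilings are determined.\<close>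
  have "\<lceil>(\<mu> - lam) / \<nu> - 1\<rceil> = 0" "\<lceil>(\<mu> - lam) / \<nu>\<rceil> = 1"
    using ratio by (auto simp: ceiling_eq_iff)
  then have resp: "customer_responses lam \<mu> \<nu> = {0}" and cap: "lounge_capacity lam \<mu> \<nu> 0 = 1"
    by (auto simp: customer_responses_def lounge_capacity_def)
  have opt: "optimal_lounge_cost lam \<mu> \<nu> \<omega> = lounge_cost lam \<mu> \<nu> \<omega> 0"
    by (simp add: optimal_lounge_cost_def resp)
  obtain g g\<^sub>o where g: "lounge_cost lam \<mu> \<nu> \<omega> 0 = ennreal g" "no_lounge_cost lam \<mu> = ennreal g\<^sub>o"
    and diff: "g\<^sub>o - g = \<rho>\<^sup>2 * (\<mu> / (\<mu> + \<nu>)) * (\<omega>_bar - \<omega>)"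
    using cost_difference[OF cap \<open>\<omega> > 0\<close>] unfolding assms(8) by metis
  have pos: "\<rho>\<^sup>2 * (\<mu> / (\<mu> + \<nu>)) \<ge> 0"
    using assms by simp
  have "g \<le> g\<^sub>o" if "\<omega> < \<omega>_bar"
    using mult_nonneg_nonneg[OF pos, of "\<omega>_bar - \<omega>"] that diff by simp
  moreover have "g\<^sub>o \<le> g" if "\<omega> \<ge> \<omega>_bar"
    using mult_nonneg_nonpos[OF pos, of "\<omega>_bar - \<omega>"] that diff by simp
  moreover have "is_arg_min (lounge_cost lam \<mu> \<nu> \<omega>) (\<lambda>A. A \<in> customer_responses lam \<mu> \<nu>) 0"
    by (simp add: is_arg_min_def resp)
  ultimately show ?thesis
    unfolding opt g by (auto simp: min_absorb1 min_absorb2 ennreal_leI)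
qed

end
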